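(* Let $n\ge k\ge 0$ be integers. Then $$\sum_{\lambda\in L_{n,k}}x^{|\lambda_o|}y^{|\lambda_e|}=\sum_{m=0}^{k}\frac{\left(x^{\lfloor m/2\rfloor+1}y^{\lfloor m/2\rfloor}\right)^{\lceil m/2\rceil}\begin{bmatrix} n-\lceil m/2\rceil\\ \lfloor m/2\rfloor\end{bmatrix}_{xy}}{(x;xy)_{\lceil m/2\rceil}\,(x^ny^{n-1};(xy)^{-1})_{\lfloor m/2\rfloor}}.$$
   Context: For $n\ge k$, $L_{n,k}$ is the set of truncated lecture hall partitions: sequences $\lambda=(\lambda_1,\ldots,\lambda_k)$ of nonnegative integers with $$\frac{\lambda_1}{n}\ge\frac{\lambda_2}{n-1}\ge\cdots\ge\frac{\lambda_k}{n-k+1}\ge 0$$ (for $k=0$ the set consists of the empty sequence only). For such $\lambda$, $\lambda_o=(\lambda_1,\lambda_3,\ldots)$ and $\lambda_e=(\lambda_2,\lambda_4,\ldots)$, and $|\cdot|$ denotes the sum of the entries of a sequence. Notation: $(a;q)_m=\prod_{i=0}^{m-1}(1-aq^i)$, so $(x^ny^{n-1};(xy)^{-1})_j=\prod_{i=0}^{j-1}(1-x^{n-i}y^{n-1-i})$; and $\begin{bmatrix} N\\ m\end{bmatrix}_q=(q^{N-m+1};q)_m/(q;q)_m$ (Gaussian polynomial). The identity is between formal power series in $x,y$. *)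

theory Defs
  imports "HOL-Computational_Algebra.Formal_Power_Series"
begin

(* The list l represents the sequence with lambda_(i+1) = l ! i; in particular the denominator
   of lambda_(i+1) is n - i. Nonnegativity of the entries is implied by the type. *)
definition truncated_lhp :: "nat \<Rightarrow> nat \<Rightarrow> nat list set" where
  "truncated_lhp n k =
     {l. length l = k \<and>
         (\<forall>i. Suc i < k \<longrightarrow>
            real (l ! i) / real (n - i) \<ge> real (l ! Suc i) / real (n - Suc i))}"

(* Odd parts in the 1-based numbering sit at even list positions. *)
definition odd_entries :: "nat list \<Rightarrow> nat list" where
  "odd_entries l = nths l {i. even i}"

definition even_entries :: "nat list \<Rightarrow> nat list" where
  "even_entries l = nths l {i. odd i}"

(* Q[[x,y]] is represented as Q[[x]][[y]]: the coefficient of x^i y^j in f is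
   fps_nth (fps_nth f j) i. *)
definition X :: "rat fps fps" where
  "X = fps_const fps_X"

definition Y :: "rat fps fps" where
  "Y = fps_X"

(* The formal sum of X^(a s) * Y^(b s) over s in S, given by its coefficients; meaningful when
   each set of elements with prescribed weights is finite (for lecture hall partitions see
   finite_truncated_lhp below). It is not a limit in the library's metric on
   (rat fps) fps, which is the Y-adic one with discrete coefficients. *)
definition bivariate_gf :: "'s set \<Rightarrow> ('s \<Rightarrow> nat) \<Rightarrow> ('s \<Rightarrow> nat) \<Rightarrow> rat fps fps" where
  "bivariate_gf S a b =
     Abs_fps (\<lambda>j. Abs_fps (\<lambda>i. of_nat (card {s \<in> S. a s = i \<and> b s = j})))"

definition qpoch :: "'a::comm_ring_1 \<Rightarrow> 'a \<Rightarrow> nat \<Rightarrow> 'a" where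
  "qpoch a q m = (\<Prod>i<m. 1 - a * q ^ i)"

definition gauss_poly :: "nat \<Rightarrow> nat \<Rightarrow> rat fps fps \<Rightarrow> rat fps fps" where
  "gauss_poly N m q = qpoch (q ^ (N - m + 1)) q m / qpoch q q m"

(* The symbol (x^n y^(n-1); (xy)^(-1))_j; the base (xy)^(-1) is not a power series, so the
   factors are written out. For j \<le> n the natural-number subtractions do not truncate. *)
definition qpoch_inv_base :: "nat \<Rightarrow> nat \<Rightarrow> rat fps fps" where
  "qpoch_inv_base n j = (\<Prod>i<j. 1 - X ^ (n - i) * Y ^ (n - 1 - i))"

lemma monomial_nth:
  "fps_nth (fps_nth (X ^ a * Y ^ b) j) i = (if i = a \<and> j = b then 1 else 0)"
  by (simp add: X_def Y_def fps_const_power fps_X_power_iff)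

lemma finite_truncated_lhp:
  "finite {l \<in> truncated_lhp n k.
             sum_list (odd_entries l) = i \<and> sum_list (even_entries l) = j}"
proof (rule finite_subset)
  show "{l \<in> truncated_lhp n k.
           sum_list (odd_entries l) = i \<and> sum_list (even_entries l) = j}
        \<subseteq> {l. set l \<subseteq> {..i + j} \<and> length l = k}"
  proof (clarsimp simp: truncated_lhp_def)
    fix l :: "nat list" and x assume "x \<in> set l"
    then obtain p where p: "p < length l" "x = l ! p"
      by (auto simp: in_set_conv_nth)
    show "x \<le> sum_list (odd_entries l) + sum_list (even_entries l)"
    proof (cases "even p")
      case True
      then have "x \<in> set (odd_entries l)"
        using p by (auto simp: odd_entries_def set_nths)
      then show ?thesis using member_le_sum_list[of x] by fastforce
    next
      case False
      then have "x \<in> set (even_entries l)"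
        using p by (auto simp: even_entries_def set_nths)
      then show ?thesis using member_le_sum_list[of x] by fastforce
    qed
  qed
  show "finite {l. set l \<subseteq> {..i + j} \<and> length l = k}"
    by (rule finite_lists_length_eq) simp
qed

(* The library's division on iterated power series is genuine division whenever the divisor
   has nonzero constant term. *)
lemma divide_bivariate_unit:
  fixes f g :: "rat fps fps"
  assumes "fps_nth (fps_nth g 0) 0 \<noteq> 0"
  shows "f / g * g = f"
proof -
  have "fps_nth g 0 \<noteq> 0" using assms by auto
  then have "f / g = f * inverse g" by (rule fps_divide_unit)
  moreover have "fps_nth g 0 * inverse (fps_nth g 0) = 1"
    using assms by (simp add: inverse_mult_eq_1')
  then have "g * inverse g = 1"
    unfolding fps_inverse_def by (rule fps_right_inverse)
  ultimately show ?thesis by (simp add: mult.assoc mult.commute)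
qed

end

(* Let P(z) be the generating function of the sequences in L_{n,m} all of whose entries are
   positive, with weight z^(|l_o| - |l_e|) q^|l_e| where q = xy and z = x. Fix the entries
   l_2, l_4, ... of such a sequence; each of l_3, l_5, ... then ranges over an interval, and l_1
   over a half-line. Let s be the excess of l_1 over its least value, and reflect the other odd-indexed
   entries in their intervals. The least predecessor and the largest successor of an entry b add up
   to 2b, so the sums telescope, and what remains next to s is a positive sequence in
   L_{n-1,m-1} whose weight has z replaced by zq. If m is even, the end of the telescoping sum
   leaves a correction M, the largest possible next entry: the pairs with s < M are the
   sequences in L_{n-1,m} with last entry M - s, the others are again free pairs. Hence
     (1-z) P_{n+1,2j+1}(z) = z P_{n,2j}(zq),
     (1-z) P_{n+1,2j+2}(z) = (1-z) P_{n,2j+2}(zq) + P_{n,2j+1}(zq),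
   and the summands of the theorem satisfy the same recurrences. *)

theory Submission
  imports Defs
begin

(* With b / (n - 1) <= a / n as the lecture hall condition on neighbours, succ_max n a is the
   largest b for given a. Dually, pred_min n b is the least a with a / (n + 1) >= b / n; it is
   written as a reflection since only the sum of the two matters in the weights. *)
definition succ_max :: "nat \<Rightarrow> nat \<Rightarrow> nat" where
  "succ_max n a = (n - 1) * a div n"

definition pred_min :: "nat \<Rightarrow> nat \<Rightarrow> nat" where
  "pred_min n b = 2 * b - succ_max n b"

lemma succ_max_le: "succ_max n a \<le> a"
proof -
  have "(n - 1) * a div n \<le> n * a div n" by (intro div_le_mono mult_le_mono1) simp
  also have "\<dots> \<le> a" by (cases "n = 0") simp_all
  finally show ?thesis by (simp add: succ_max_def)
qed

lemma pred_min_add_succ_max: "pred_min n b + succ_max n b = 2 * b"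
  using succ_max_le[of n b] by (simp add: pred_min_def)

lemma le_succ_max_iff: "0 < n \<Longrightarrow> b \<le> succ_max n a \<longleftrightarrow> n * b \<le> (n - 1) * a"
  by (simp add: succ_max_def less_eq_div_iff_mult_less_eq mult.commute)

text \<open>Because (n+1)b/n = 2b - (n-1)b/n, reflecting the floor \<open>succ_max n b\<close> in b
  gives the ceiling of (n+1)b/n.\<close>

lemma pred_min_le_iff:
  assumes "0 < n"
  shows "pred_min n b \<le> a \<longleftrightarrow> Suc n * b \<le> n * a"
proof -
  obtain m where n: "n = Suc m" using assms by (cases n) auto
  have "pred_min n b \<le> a \<longleftrightarrow> 2 * b - a \<le> succ_max n b"
    by (auto simp: pred_min_def)
  also have "\<dots> \<longleftrightarrow> n * (2 * b - a) \<le> m * b"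
    using assms by (simp add: le_succ_max_iff n)
  also have "\<dots> \<longleftrightarrow> n * (2 * b) \<le> m * b + n * a"
    by (simp only: diff_mult_distrib2) linarith
  also have "\<dots> \<longleftrightarrow> Suc n * b \<le> n * a" by (simp add: n algebra_simps mult_2_right)
  finally show ?thesis .
qed

section \<open>The lecture hall condition as a recursive predicate\<close>

text \<open>Cross-multiplied chain condition, with \<open>n\<close> the denominator of the first
  entry. The singleton clause \<open>0 < n\<close> keeps every denominator positive; this bounds the
  length by \<open>n\<close> and prevents \<open>n - 1\<close> from truncating.\<close>

fun lecture_hall :: "nat \<Rightarrow> nat list \<Rightarrow> bool" where
  "lecture_hall n [] = True"
| "lecture_hall n [a] = (0 < n)"
| "lecture_hall n (a # b # l) = (n * b \<le> (n - 1) * a \<and> lecture_hall (n - 1) (b # l))"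

lemma lecture_hall_Cons_pos: "lecture_hall n (a # l) \<Longrightarrow> 0 < n"
proof (induction l arbitrary: n a)
  case (Cons b l)
  then have "0 < n - 1" by (intro Cons.IH) auto
  then show ?case by simp
qed simp

lemma lecture_hall_ConsD: "lecture_hall n (a # l) \<Longrightarrow> lecture_hall (n - 1) l"
  by (cases l) auto

lemma lecture_hall_length: "lecture_hall n l \<Longrightarrow> length l \<le> n"
proof (induction l arbitrary: n)
  case (Cons a l)
  then show ?case
    using lecture_hall_Cons_pos[OF Cons.prems] Cons.IH[OF lecture_hall_ConsD[OF Cons.prems]] by simp
qed simp

lemma lecture_hall_Cons2_iff:
  "lecture_hall n (a # b # l) \<longleftrightarrow> b \<le> succ_max n a \<and> lecture_hall (n - 1) (b # l)"
  using lecture_hall_Cons_pos[of "n - 1" b l] by (auto simp: le_succ_max_iff)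

lemma lecture_hall_Suc_Cons2_iff:
  "lecture_hall (Suc n) (a # b # l) \<longleftrightarrow> pred_min n b \<le> a \<and> lecture_hall n (b # l)"
  using lecture_hall_Cons_pos[of n b l] by (auto simp: pred_min_le_iff)

lemma truncated_lhp_eq:
  assumes "k \<le> n"
  shows "truncated_lhp n k = {l. length l = k \<and> lecture_hall n l}"
proof -
  have ratio: "real b / real (n - Suc i) \<le> real a / real (n - i)
      \<longleftrightarrow> (n - i) * b \<le> (n - Suc i) * a" if "Suc i < n" for n i a b
  proof -
    have "real b / real (n - Suc i) \<le> real a / real (n - i)
        \<longleftrightarrow> real ((n - i) * b) \<le> real ((n - Suc i) * a)"
      using that by (simp add: divide_simps mult.commute del: of_nat_diff)
    then show ?thesis by (simp only: of_nat_le_iff)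
  qed
  have "(\<forall>i. Suc i < length l \<longrightarrow>
          real (l ! Suc i) / real (n - Suc i) \<le> real (l ! i) / real (n - i))
        \<longleftrightarrow> lecture_hall n l" if "length l \<le> n" for l
    using that
  proof (induction n l rule: lecture_hall.induct)
    case (3 n a b l)
    let ?P = "\<lambda>n l i. real (l ! Suc i) / real (n - Suc i) \<le> real (l ! i) / real (n - i)"
    have "(\<forall>i. Suc i < length (a # b # l) \<longrightarrow> ?P n (a # b # l) i)
       \<longleftrightarrow> ?P n (a # b # l) 0
         \<and> (\<forall>i. Suc i < length (b # l) \<longrightarrow> ?P (n - 1) (b # l) i)"
      by (simp add: All_less_Suc2)
    also have "?P n (a # b # l) 0 \<longleftrightarrow> n * b \<le> (n - 1) * a"
      using ratio[of 0 n b a] "3.prems" by simp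
    also have "(\<forall>i. Suc i < length (b # l) \<longrightarrow> ?P (n - 1) (b # l) i) \<longleftrightarrow> lecture_hall (n - 1) (b # l)"
      using "3.prems" by (intro "3.IH") simp
    finally show ?case by simp
  qed auto
  with assms show ?thesis by (auto simp: truncated_lhp_def)
qed

declare lecture_hall.simps(3) [simp del]

text \<open>The last entry of \<open>l\<close> has denominator \<open>n + 1 - length l\<close>. If
  this is 1, no denominator is left for \<open>c\<close>; then \<open>succ_max\<close> is 0, so the
  right-hand side also fails, but only because \<open>c\<close> is positive.\<close>

lemma lecture_hall_snoc:
  "l \<noteq> [] \<Longrightarrow> 0 < c \<Longrightarrow> lecture_hall n (l @ [c]) \<longleftrightarrow>
     lecture_hall n l \<and> c \<le> succ_max (n + 1 - length l) (last l)"
proof (induction n l rule: lecture_hall.induct)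
  case (2 n a)
  then show ?case
    by (cases "n = 0"; cases "n = 1") (auto simp: lecture_hall_Cons2_iff succ_max_def)
qed (auto simp: lecture_hall.simps)

lemma lecture_hall_snoc_0: "lecture_hall n (l @ [0]) \<longleftrightarrow> lecture_hall n l \<and> length l < n"
  by (induction n l rule: lecture_hall.induct) (auto simp: lecture_hall.simps)

text \<open>Positivity propagates to the left: \<open>n * b <= (n - 1) * a\<close> with
  \<open>b > 0\<close> forces \<open>a > 0\<close>. So the last entry alone decides whether all
  entries are positive.\<close>

lemma lecture_hall_snoc_pos:
  "lecture_hall n (l @ [c]) \<Longrightarrow> 0 < c \<Longrightarrow> 0 \<notin> set l"
proof (induction n l rule: lecture_hall.induct)
  case (3 n a b l)
  then have "0 < b" by (auto simp: lecture_hall.simps)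
  moreover have "0 < n" using lecture_hall_Cons_pos[of n a "b # l @ [c]"] "3.prems" by simp
  ultimately have "0 < a" using "3.prems" by (cases a) (auto simp: lecture_hall.simps)
  with 3 show ?case by (auto simp: lecture_hall.simps)
qed (auto simp: lecture_hall.simps intro: Nat.gr0I)

section \<open>Sums over odd- and even-indexed entries\<close>

lemma odd_entries_Nil [simp]: "odd_entries [] = []"
  and even_entries_Nil [simp]: "even_entries [] = []"
  and odd_entries_Cons [simp]: "odd_entries (a # l) = a # even_entries l"
  and even_entries_Cons [simp]: "even_entries (a # l) = odd_entries l"
  by (simp_all add: odd_entries_def even_entries_def nths_Cons)

abbreviation odd_sum :: "nat list \<Rightarrow> nat" where
  "odd_sum l \<equiv> sum_list (odd_entries l)"

abbreviation even_sum :: "nat list \<Rightarrow> nat" where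
  "even_sum l \<equiv> sum_list (even_entries l)"

lemma entries_sum_snoc:
  "odd_sum (l @ [c]) = (if even (length l) then odd_sum l + c else odd_sum l)"
  "even_sum (l @ [c]) = (if even (length l) then even_sum l else even_sum l + c)"
  by (induction l) auto

text \<open>Each even-indexed entry is at most its predecessor, since
  \<open>succ_max n a <= a\<close>. Hence the difference of the two sums does not truncate on
  lecture hall lists.\<close>

lemma even_sum_le_odd_sum: "lecture_hall n l \<Longrightarrow> even_sum l \<le> odd_sum l"
proof (induction l arbitrary: n rule: induct_list012)
  case (3 a b l)
  then have "lecture_hall (n - 1 - 1) l" "b \<le> succ_max n a"
    using lecture_hall_ConsD[of "n - 1" b l] by (auto simp: lecture_hall_Cons2_iff)
  with "3.IH"(1) succ_max_le[of n a] show ?case by fastforce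
qed auto

section \<open>The reflection bijection\<close>

definition excess :: "nat list \<Rightarrow> nat" where
  "excess l = odd_sum l - even_sum l"

(* Inverse of the reflection: l is taken with leading denominator n, the result has leading
   denominator Suc n. The value succ_max n b - c plays the role of s for the tail. *)
fun lift_lhp :: "nat \<Rightarrow> nat \<Rightarrow> nat list \<Rightarrow> nat list" where
  "lift_lhp n s [] = [Suc s]"
| "lift_lhp n s [b] = [s + pred_min n b, b]"
| "lift_lhp n s (b # c # l) = (s + pred_min n b) # b # lift_lhp (n - 2) (succ_max n b - c) l"

lemma length_lift_lhp [simp]: "length (lift_lhp n s l) = Suc (length l)"
  by (induction n s l rule: lift_lhp.induct) auto

text \<open>The leading entry is \<open>s\<close> plus its least admissible value; without a
  successor this value is 1, as entries are to be positive.\<close>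

lemma hd_lift_lhp: "hd (lift_lhp n s l) = s + (case l of [] \<Rightarrow> 1 | b # _ \<Rightarrow> pred_min n b)"
  by (cases "(n, s, l)" rule: lift_lhp.cases) auto

lemma pred_min_ge: "b \<le> pred_min n b"
  using succ_max_le[of n b] by (simp add: pred_min_def)

text \<open>The entry \<open>c\<close> and its reflection lie between the same neighbours and carry
  the same denominator, so reflection in the admissible interval preserves both bounds.\<close>

lemma lift_lhp_lecture_hall:
  assumes "lecture_hall n l" "0 \<notin> set l"
  shows "lecture_hall (Suc n) (lift_lhp n s l) \<and> 0 \<notin> set (lift_lhp n s l)"
  using assms
proof (induction n s l rule: lift_lhp.induct)
  case (2 n s b)
  then show ?case using pred_min_ge[of b n] by (auto simp: lecture_hall_Suc_Cons2_iff)
next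
  case (3 n s b c l)
  have c: "c \<le> succ_max n b" "0 < c" and cl: "lecture_hall (n - 1) (c # l)"
    using "3.prems" by (auto simp: lecture_hall_Cons2_iff)
  have n: "Suc (n - 2) = n - 1" using lecture_hall_Cons_pos[OF cl] by simp
  have "lecture_hall (n - 1 - 1) l" using lecture_hall_ConsD[OF cl] .
  then have l: "lecture_hall (n - 2) l" by (simp add: numeral_2_eq_2)
  define u where "u = lift_lhp (n - 2) (succ_max n b - c) l"
  have u: "lecture_hall (n - 1) u" "0 \<notin> set u"
    using "3.IH" l "3.prems" by (auto simp: u_def n)
  obtain h t where ht: "u = h # t" by (cases u) (auto simp: u_def dest: arg_cong[of _ _ length])
  \<comment> \<open>The two bounds change roles: the lower bound on \<open>c\<close> (1 if nothing
    follows, else \<open>pred_min (n - 2) d\<close>) becomes the upper bound on its reflection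
    \<open>h\<close>.\<close>
  have "h \<le> succ_max n b"
  proof (cases l)
    case Nil
    then show ?thesis using c ht by (auto simp: u_def)
  next
    case (Cons d l')
    then have "pred_min (n - 2) d \<le> c" using cl n lecture_hall_Suc_Cons2_iff[of "n - 2" c d l'] by simp
    moreover have "h = succ_max n b - c + pred_min (n - 2) d"
      using hd_lift_lhp[of "n - 2" "succ_max n b - c" l] ht Cons by (simp add: u_def)
    ultimately show ?thesis using c by simp
  qed
  then have "lecture_hall n (b # u)" using u ht by (simp add: lecture_hall_Cons2_iff)
  then show ?case using u "3.prems" pred_min_ge[of b n]
    by (auto simp: lecture_hall_Suc_Cons2_iff simp flip: u_def)
qed auto

text \<open>The odd-indexed entries of \<open>l\<close> can be read off the lifted list. The others
  are recovered from \<open>succ_max n b - c\<close>, which determines \<open>c\<close> because the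
  lecture hall condition gives \<open>c <= succ_max n b\<close>.\<close>

lemma lift_lhp_inj:
  assumes "lift_lhp n s l = lift_lhp n s' l'" "lecture_hall n l" "lecture_hall n l'"
  shows "s = s' \<and> l = l'"
  using assms
proof (induction n s l arbitrary: s' l' rule: lift_lhp.induct)
  case (1 n s)
  then show ?case by (cases "(n, s', l')" rule: lift_lhp.cases) (auto dest: arg_cong[of _ _ length])
next
  case (2 n s b)
  then show ?case by (cases "(n, s', l')" rule: lift_lhp.cases) (auto dest: arg_cong[of _ _ length])
next
  case (3 n s b c l)
  from "3.prems"(1) have "length l' = length (b # c # l)" by (metis length_lift_lhp nat.inject)
  then obtain b' c' m where l': "l' = b' # c' # m" by (auto simp: length_Suc_conv)
  have "b' = b" using 3 l' by auto
  moreover have "lecture_hall (n - 2) l" "lecture_hall (n - 2) m"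
    "c \<le> succ_max n b" "c' \<le> succ_max n b'"
    using "3.prems" lecture_hall_ConsD[of "n - 1" c l] lecture_hall_ConsD[of "n - 1" c' m]
    by (auto simp: lecture_hall_Cons2_iff l' numeral_2_eq_2)
  ultimately show ?case
    using "3.IH"[of "succ_max n b' - c'" m] "3.prems"(1) l' by auto
qed

lemma lift_lhp_surj:
  assumes "lecture_hall (Suc n) l" "0 \<notin> set l" "l \<noteq> []"
  shows "\<exists>s m. lecture_hall n m \<and> 0 \<notin> set m \<and> lift_lhp n s m = l"
  using assms
proof (induction l arbitrary: n rule: induct_list012)
  case (2 a)
  then have "lift_lhp n (a - 1) [] = [a]" by simp
  then show ?case by (intro exI[of _ "a - 1"] exI[of _ "[]"]) auto
next
  case (3 a b l)
  have b: "pred_min n b \<le> a" "lecture_hall n (b # l)"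
    using "3.prems" by (auto simp: lecture_hall_Suc_Cons2_iff)
  show ?case
  proof (cases l)
    case Nil
    then show ?thesis using b "3.prems"
      by (intro exI[of _ "a - pred_min n b"] exI[of _ "[b]"]) auto
  next
    case (Cons c r)
    have cr: "c \<le> succ_max n b" "lecture_hall (n - 1) (c # r)"
      using b Cons by (auto simp: lecture_hall_Cons2_iff)
    have n: "Suc (n - 2) = n - 1" using lecture_hall_Cons_pos[OF cr(2)] by simp
    have "\<exists>s m. lecture_hall (n - 2) m \<and> 0 \<notin> set m \<and> lift_lhp (n - 2) s m = l"
      using "3.prems" cr by (intro "3.IH"(1)) (auto simp: n Cons)
    then obtain s m where m: "lecture_hall (n - 2) m" "0 \<notin> set m" "lift_lhp (n - 2) s m = l" by blast
    have c: "c = s + (case m of [] \<Rightarrow> 1 | d # _ \<Rightarrow> pred_min (n - 2) d)"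
      using hd_lift_lhp[of "n - 2" s m] m(3) Cons by simp
    \<comment> \<open>Reflection is an involution: \<open>e\<close> is \<open>c\<close> reflected
      back, since \<open>s\<close> is the excess of \<open>c\<close> over its least value.\<close>
    define e where "e = succ_max n b - s"
    have "s \<le> succ_max n b" using c cr by simp
    then have s: "s = succ_max n b - e" by (simp add: e_def)
    have e: "0 < e"
    proof (cases m)
      case (Cons d m')
      then have "0 < pred_min (n - 2) d" using m(2) pred_min_ge[of d "n - 2"] by auto
      then show ?thesis using c cr Cons by (simp add: e_def)
    qed (use c cr in \<open>simp add: e_def\<close>)
    have "lecture_hall (n - 1) (e # m)"
    proof (cases m)
      case (Cons d m')
      then have "pred_min (n - 2) d \<le> e" using c cr by (simp add: e_def)
      then show ?thesis using m n Cons lecture_hall_Suc_Cons2_iff[of "n - 2" e d m'] by simp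
    qed (use n in auto)
    then have "lecture_hall n (b # e # m)" by (simp add: lecture_hall_Cons2_iff e_def)
    moreover have "lift_lhp n (a - pred_min n b) (b # e # m) = a # b # l"
      using b m(3) s by simp
    ultimately show ?thesis using "3.prems" m e
      by (intro exI[of _ "a - pred_min n b"] exI[of _ "b # e # m"]) auto
  qed
qed auto

lemma even_sum_lift_lhp: "even_sum (lift_lhp n s l) = odd_sum l"
  by (induction n s l rule: lift_lhp.induct) auto

text \<open>The telescoping sum, written additively to avoid subtraction: each
  \<open>pred_min n b\<close> meets the \<open>succ_max n b\<close> of the following reflection, and
  together they give \<open>2 * b\<close>. For odd length the last \<open>pred_min\<close> finds no
  partner, which leaves the \<open>succ_max\<close> term; for even length the recursion ends in
  \<open>[Suc s]\<close>, which leaves the 1.\<close>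

lemma odd_sum_lift_lhp:
  assumes "lecture_hall n l"
  shows "odd_sum (lift_lhp n s l) + even_sum l
       + (if odd (length l) then succ_max (n + 1 - length l) (last l) else 0)
       = s + 2 * odd_sum l + (if odd (length l) then 0 else 1)"
  using assms
proof (induction n s l rule: lift_lhp.induct)
  case (2 n s b)
  then show ?case using pred_min_add_succ_max[of n b] by simp
next
  case (3 n s b c l)
  have "lecture_hall (n - 2) l" "c \<le> succ_max n b"
    using "3.prems" lecture_hall_ConsD[of "n - 1" c l] by (auto simp: lecture_hall_Cons2_iff numeral_2_eq_2)
  then obtain d where "lecture_hall (n - 2) l" "succ_max n b = c + d" by (auto dest: le_Suc_ex)
  moreover have "Suc n - length (b # c # l) = Suc (n - 2) - length l"
    using lecture_hall_length[OF "3.prems"] by simp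
  ultimately show ?case using "3.IH" pred_min_add_succ_max[of n b] by (auto split: if_splits)
qed auto

subsection \<open>Bivariate generating functions\<close>

text \<open>\<open>card\<close> of an infinite set is 0, so additivity of
  \<open>bivariate_gf\<close> over disjoint unions is secured by requiring that each pair of weights
  occurs finitely often.\<close>

definition finite_fibres :: "'s set \<Rightarrow> ('s \<Rightarrow> nat) \<Rightarrow> ('s \<Rightarrow> nat) \<Rightarrow> bool" where
  "finite_fibres S a b \<longleftrightarrow> (\<forall>i j. finite {s \<in> S. a s = i \<and> b s = j})"

lemma bivariate_gf_nth:
  "fps_nth (fps_nth (bivariate_gf S a b) j) i = of_nat (card {s \<in> S. a s = i \<and> b s = j})"
  by (simp add: bivariate_gf_def)

lemma bivariate_gf_bij_betw:
  assumes "bij_betw h S T"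
    and "\<And>s. s \<in> S \<Longrightarrow> a s = a' (h s)" and "\<And>s. s \<in> S \<Longrightarrow> b s = b' (h s)"
  shows "bivariate_gf S a b = bivariate_gf T a' b'"
proof -
  have "bij_betw h {s \<in> S. a s = i \<and> b s = j} {t \<in> T. a' t = i \<and> b' t = j}" for i j
    using assms unfolding bij_betw_def inj_on_def by auto
  then have "card {s \<in> S. a s = i \<and> b s = j} = card {t \<in> T. a' t = i \<and> b' t = j}" for i j
    by (rule bij_betw_same_card)
  then show ?thesis by (simp only: bivariate_gf_def)
qed

lemma bivariate_gf_cong:
  assumes "\<And>s. s \<in> S \<Longrightarrow> a s = a' s" and "\<And>s. s \<in> S \<Longrightarrow> b s = b' s"
  shows "bivariate_gf S a b = bivariate_gf S a' b'"
  using assms by (intro bivariate_gf_bij_betw[where h = id]) auto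

lemma finite_fibres_inj_on:
  assumes "finite_fibres T a' b'" "inj_on h S" "h ` S \<subseteq> T"
    and "\<And>s. s \<in> S \<Longrightarrow> a s = a' (h s)" and "\<And>s. s \<in> S \<Longrightarrow> b s = b' (h s)"
  shows "finite_fibres S a b"
  unfolding finite_fibres_def
proof (intro allI)
  fix i j
  show "finite {s \<in> S. a s = i \<and> b s = j}"
  proof (rule inj_on_finite)
    show "inj_on h {s \<in> S. a s = i \<and> b s = j}" using assms(2) by (rule inj_on_subset) auto
    show "h ` {s \<in> S. a s = i \<and> b s = j} \<subseteq> {t \<in> T. a' t = i \<and> b' t = j}"
      using assms by auto
    show "finite {t \<in> T. a' t = i \<and> b' t = j}" using assms(1) by (simp add: finite_fibres_def)
  qed
qed

lemma bivariate_gf_Un: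
  assumes "finite_fibres S a b" "finite_fibres T a b" "S \<inter> T = {}"
  shows "bivariate_gf (S \<union> T) a b = bivariate_gf S a b + bivariate_gf T a b"
proof -
  have "card {s \<in> S \<union> T. a s = i \<and> b s = j}
      = card {s \<in> S. a s = i \<and> b s = j} + card {s \<in> T. a s = i \<and> b s = j}" for i j
  proof -
    have "{s \<in> S \<union> T. a s = i \<and> b s = j} = {s \<in> S. a s = i \<and> b s = j} \<union> {s \<in> T. a s = i \<and> b s = j}"
      by auto
    then show ?thesis
      using assms by (simp add: finite_fibres_def card_Un_disjoint disjoint_iff)
  qed
  then show ?thesis by (simp add: fps_eq_iff bivariate_gf_nth)
qed

lemma monomial_mult_nth:
  "fps_nth (fps_nth (X ^ c * Y ^ d * f) j) i
     = (if c \<le> i \<and> d \<le> j then fps_nth (fps_nth f (j - d)) (i - c) else 0)"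
  by (simp add: X_def Y_def fps_const_power fps_X_power_mult_nth mult.assoc)

lemma bivariate_gf_add:
  "bivariate_gf S (\<lambda>s. a s + c) (\<lambda>s. b s + d) = X ^ c * Y ^ d * bivariate_gf S a b"
proof -
  have "{s \<in> S. a s + c = i \<and> b s + d = j}
      = (if c \<le> i \<and> d \<le> j then {s \<in> S. a s = i - c \<and> b s = j - d} else {})" for i j
    by auto
  then show ?thesis by (simp add: fps_eq_iff bivariate_gf_nth monomial_mult_nth)
qed

text \<open>A free coordinate \<open>t\<close> contributes a geometric series: the pairs with
  \<open>t = 0\<close> are a copy of \<open>S\<close>, and those with \<open>t > 0\<close> are all
  pairs shifted by one.\<close>

lemma bivariate_gf_geometric:
  assumes "finite_fibres S a b" "0 < c"
  shows "bivariate_gf (UNIV \<times> S) (\<lambda>(t, s). a s + c * t) (\<lambda>(t, s). b s + d * t)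
           * (1 - X ^ c * Y ^ d) = bivariate_gf S a b"
proof -
  let ?a = "\<lambda>(t, s). a s + c * t" and ?b = "\<lambda>(t, s). b s + d * t"
  let ?G = "bivariate_gf (UNIV \<times> S) ?a ?b"
  have fin: "finite_fibres (UNIV \<times> S) ?a ?b"
    unfolding finite_fibres_def
  proof (intro allI)
    fix i j
    \<comment> \<open>Here \<open>0 < c\<close> enters: the X-weight bounds \<open>t\<close>, which
      makes the fibres finite.\<close>
    have "t \<le> c * t" for t using assms(2) by simp
    then have "t \<le> a s + c * t" for t s by (meson trans_le_add2)
    then have "{p \<in> UNIV \<times> S. ?a p = i \<and> ?b p = j}
        \<subseteq> (\<Union>i'\<le>i. \<Union>j'\<le>j. {..i} \<times> {s \<in> S. a s = i' \<and> b s = j'})"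
      by auto
    then show "finite {p \<in> UNIV \<times> S. ?a p = i \<and> ?b p = j}"
      by (rule finite_subset) (use assms(1) in \<open>simp add: finite_fibres_def\<close>)
  qed
  have "(UNIV :: nat set) \<times> S = {0} \<times> S \<union> {0<..} \<times> S" by auto
  moreover have "bivariate_gf ({0} \<times> S \<union> {0<..} \<times> S) ?a ?b
      = bivariate_gf ({0} \<times> S) ?a ?b + bivariate_gf ({0<..} \<times> S) ?a ?b"
    by (intro bivariate_gf_Un finite_fibres_inj_on[OF fin, of id]) auto
  moreover have "bivariate_gf S a b = bivariate_gf ({0} \<times> S) ?a ?b"
    by (intro bivariate_gf_bij_betw[where h = "Pair 0"]) (auto simp: bij_betw_def inj_on_def)
  moreover have "bivariate_gf (UNIV \<times> S) (\<lambda>p. ?a p + c) (\<lambda>p. ?b p + d)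
      = bivariate_gf ({0<..} \<times> S) ?a ?b"
  proof (intro bivariate_gf_bij_betw[where h = "\<lambda>(t, s). (Suc t, s)"])
    show "bij_betw (\<lambda>(t, s). (Suc t, s)) (UNIV \<times> S) ({0<..} \<times> S)"
      by (rule bij_betw_byWitness[where f' = "\<lambda>(t, s). (t - 1, s)"]) auto
  qed auto
  ultimately have "?G = bivariate_gf S a b + X ^ c * Y ^ d * ?G"
    by (simp only: bivariate_gf_add)
  then show ?thesis by (simp add: algebra_simps)
qed

subsection \<open>Recurrences\<close>

definition positive_lhp :: "nat \<Rightarrow> nat \<Rightarrow> nat list set" where
  "positive_lhp n m = {l. length l = m \<and> lecture_hall n l \<and> 0 \<notin> set l}"

(* The substitution z -> zq cannot be carried out in the ring of power series in x and y, so it is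
   built into the weights: i substitutions turn z into X * (X * Y)^i. *)
definition x_weight :: "nat \<Rightarrow> nat list \<Rightarrow> nat" where
  "x_weight i l = Suc i * excess l + even_sum l"

definition y_weight :: "nat \<Rightarrow> nat list \<Rightarrow> nat" where
  "y_weight i l = i * excess l + even_sum l"

text \<open>In the notation of the recurrences this is P_{n,m}(z q^i) at z = x.\<close>

definition positive_gf :: "nat \<Rightarrow> nat \<Rightarrow> nat \<Rightarrow> rat fps fps" where
  "positive_gf i n m = bivariate_gf (positive_lhp n m) (x_weight i) (y_weight i)"

text \<open>The weights dominate \<open>odd_sum\<close> and \<open>even_sum\<close>, so each fibre
  is covered by finitely many fibres of \<open>truncated_lhp n k\<close>.\<close>

lemma finite_fibres_lecture_hall:
  "finite_fibres {l. length l = k \<and> lecture_hall n l} (x_weight i) (y_weight i)"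
proof (cases "k \<le> n")
  case True
  show ?thesis unfolding finite_fibres_def
  proof (intro allI)
    fix a b
    have "odd_sum l \<le> x_weight i l" "even_sum l \<le> y_weight i l" if "lecture_hall n l" for l
      using even_sum_le_odd_sum[OF that] by (simp_all add: x_weight_def y_weight_def excess_def)
    then have "{l \<in> {l. length l = k \<and> lecture_hall n l}. x_weight i l = a \<and> y_weight i l = b}
        \<subseteq> (\<Union>a'\<le>a. \<Union>b'\<le>b. {l \<in> truncated_lhp n k. odd_sum l = a' \<and> even_sum l = b'})"
      using True by (auto simp: truncated_lhp_eq)
    then show "finite {l \<in> {l. length l = k \<and> lecture_hall n l}. x_weight i l = a \<and> y_weight i l = b}"
      by (rule finite_subset) (simp add: finite_truncated_lhp)
  qed
next
  case False
  then have "{l. length l = k \<and> lecture_hall n l} = {}" using lecture_hall_length by force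
  then show ?thesis by (simp only: finite_fibres_def) simp
qed

lemma finite_fibres_positive_lhp: "finite_fibres (positive_lhp n m) (x_weight i) (y_weight i)"
  by (rule finite_fibres_inj_on[OF finite_fibres_lecture_hall[of m n i], of id])
     (auto simp: positive_lhp_def)

lemma bij_betw_lift_lhp:
  "bij_betw (\<lambda>(s, l). lift_lhp n s l) (UNIV \<times> positive_lhp n m) (positive_lhp (Suc n) (Suc m))"
  unfolding bij_betw_def
proof (intro conjI equalityI subsetI)
  show "inj_on (\<lambda>(s, l). lift_lhp n s l) (UNIV \<times> positive_lhp n m)"
    using lift_lhp_inj by (auto simp: inj_on_def positive_lhp_def)
next
  fix l assume "l \<in> (\<lambda>(s, l). lift_lhp n s l) ` (UNIV \<times> positive_lhp n m)"
  then show "l \<in> positive_lhp (Suc n) (Suc m)"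
    using lift_lhp_lecture_hall by (auto simp: positive_lhp_def)
next
  fix l assume l: "l \<in> positive_lhp (Suc n) (Suc m)"
  then have "l \<noteq> []" by (auto simp: positive_lhp_def)
  then obtain s r where "lecture_hall n r" "0 \<notin> set r" "lift_lhp n s r = l"
    using l lift_lhp_surj[of n l] by (auto simp: positive_lhp_def)
  moreover from this have "length r = m" using l by (auto simp: positive_lhp_def)
  ultimately show "l \<in> (\<lambda>(s, l). lift_lhp n s l) ` (UNIV \<times> positive_lhp n m)"
    by (intro image_eqI[of _ _ "(s, r)"]) (auto simp: positive_lhp_def)
qed

text \<open>Under \<open>lift_lhp\<close> the weight becomes z * z^s * (zq)^(excess l) * q^(even_sum
  l); summing over the free \<open>s\<close> gives 1/(1 - z).\<close>

lemma positive_gf_Suc_even: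
  assumes "even m"
  shows "positive_gf i (Suc n) (Suc m) * (1 - X ^ Suc i * Y ^ i)
       = X ^ Suc i * Y ^ i * positive_gf (Suc i) n m"
proof -
  let ?S = "UNIV \<times> positive_lhp n m"
  have ex: "excess (lift_lhp n s l) = s + excess l + 1"
    and ev: "even_sum (lift_lhp n s l) = even_sum l + excess l"
    if "l \<in> positive_lhp n m" for s l
    using that odd_sum_lift_lhp[of n l s] even_sum_le_odd_sum[of n l] assms
    by (auto simp: positive_lhp_def excess_def even_sum_lift_lhp)
  define G where "G = bivariate_gf ?S (\<lambda>(s, l). x_weight (Suc i) l + Suc i * s)
      (\<lambda>(s, l). y_weight (Suc i) l + i * s)"
  have "positive_gf i (Suc n) (Suc m)
      = bivariate_gf ?S (\<lambda>p. (case p of (s, l) \<Rightarrow> x_weight (Suc i) l + Suc i * s) + Suc i)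
          (\<lambda>p. (case p of (s, l) \<Rightarrow> y_weight (Suc i) l + i * s) + i)"
    unfolding positive_gf_def
    by (rule sym, rule bivariate_gf_bij_betw[OF bij_betw_lift_lhp])
       (auto simp: x_weight_def y_weight_def ex ev algebra_simps)
  also have "\<dots> = X ^ Suc i * Y ^ i * G"
    unfolding G_def by (rule bivariate_gf_add)
  finally have "positive_gf i (Suc n) (Suc m) * (1 - X ^ Suc i * Y ^ i)
      = X ^ Suc i * Y ^ i * (G * (1 - X ^ Suc i * Y ^ i))"
    by (simp only: mult.assoc)
  also have "G * (1 - X ^ Suc i * Y ^ i) = positive_gf (Suc i) n m"
    unfolding positive_gf_def G_def by (rule bivariate_gf_geometric[OF finite_fibres_positive_lhp]) simp
  finally show ?thesis .
qed

lemma positive_gf_Suc_odd: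
  assumes "odd m"
  shows "positive_gf i (Suc n) (Suc m) * (1 - X ^ Suc i * Y ^ i)
       = positive_gf (Suc i) n (Suc m) * (1 - X ^ Suc i * Y ^ i) + positive_gf (Suc i) n m"
proof -
  define M where "M l = succ_max (n + 1 - m) (last l)" for l
  define a where "a = (\<lambda>(s, l). x_weight i (lift_lhp n s l))"
  define b where "b = (\<lambda>(s, l). y_weight i (lift_lhp n s l))"
  let ?P = "positive_lhp n m"
  \<comment> \<open>The lifted excess is \<open>s + excess l - M l\<close>. For \<open>s\<close>
    below \<open>M l\<close> the shortfall is absorbed in a new last entry; otherwise
    \<open>s - M l\<close> is a free parameter.\<close>
  let ?S = "{(s, l). l \<in> ?P \<and> s < M l}" and ?T = "{(s, l). l \<in> ?P \<and> M l \<le> s}"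
  have ex: "excess (lift_lhp n s l) + M l = s + excess l"
    and ev: "even_sum (lift_lhp n s l) = even_sum l + excess l"
    if "l \<in> ?P" for s l
    using that odd_sum_lift_lhp[of n l s] even_sum_le_odd_sum[of n l] assms
      lift_lhp_lecture_hall[of n l s] even_sum_le_odd_sum[of "Suc n" "lift_lhp n s l"]
    by (auto simp: positive_lhp_def excess_def even_sum_lift_lhp M_def)
  have fin: "finite_fibres (UNIV \<times> ?P) a b"
    using bij_betw_lift_lhp[of n m]
    by (intro finite_fibres_inj_on[OF finite_fibres_positive_lhp[of "Suc n" "Suc m" i],
          of "\<lambda>(s, l). lift_lhp n s l"]) (auto simp: a_def b_def bij_betw_def)
  have "positive_gf i (Suc n) (Suc m) = bivariate_gf (UNIV \<times> ?P) a b"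
    unfolding positive_gf_def
    by (rule sym, rule bivariate_gf_bij_betw[OF bij_betw_lift_lhp]) (auto simp: a_def b_def)
  also have "UNIV \<times> ?P = ?S \<union> ?T" by auto
  also have "bivariate_gf (?S \<union> ?T) a b = bivariate_gf ?S a b + bivariate_gf ?T a b"
    by (intro bivariate_gf_Un finite_fibres_inj_on[OF fin, of id]) auto
  also have "bivariate_gf ?S a b = positive_gf (Suc i) n (Suc m)"
    unfolding positive_gf_def
  proof (rule bivariate_gf_bij_betw)
    let ?h = "\<lambda>(s, l). l @ [M l - s]"
    \<comment> \<open>As \<open>s\<close> runs through 0, ..., M l - 1, the value
      \<open>M l - s\<close> runs through exactly the positive entries that may follow
      \<open>l\<close>.\<close>
    have snoc: "l @ [c] \<in> positive_lhp n (Suc m) \<longleftrightarrow> l \<in> ?P \<and> 0 < c \<and> c \<le> M l" for l c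
      using assms lecture_hall_snoc[of l c n] by (cases "l = []") (auto simp: positive_lhp_def M_def)
    show "bij_betw ?h ?S (positive_lhp n (Suc m))"
      unfolding bij_betw_def
    proof (intro conjI equalityI subsetI)
      show "inj_on ?h ?S" by (auto simp: inj_on_def)
    next
      fix l assume "l \<in> ?h ` ?S"
      then show "l \<in> positive_lhp n (Suc m)" by (auto simp: snoc)
    next
      fix l assume l: "l \<in> positive_lhp n (Suc m)"
      then obtain r c where rc: "l = r @ [c]" by (cases l rule: rev_cases) (auto simp: positive_lhp_def)
      then have "l = ?h (M r - c, r)" "(M r - c, r) \<in> ?S" using l snoc[of r c] by auto
      then show "l \<in> ?h ` ?S" by blast
    qed
    fix p assume "p \<in> ?S"
    then obtain s l where p: "p = (s, l)" and l: "l \<in> ?P" and s: "s < M l" by auto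
    have "l @ [M l - s] \<in> positive_lhp n (Suc m)" using l s by (simp add: snoc)
    then have "even_sum (l @ [M l - s]) \<le> odd_sum (l @ [M l - s])"
      using even_sum_le_odd_sum by (auto simp: positive_lhp_def)
    then have "excess (l @ [M l - s]) + (M l - s) = excess l"
      and ev': "even_sum (l @ [M l - s]) = even_sum l + (M l - s)"
      using l assms by (auto simp: positive_lhp_def entries_sum_snoc excess_def)
    \<comment> \<open>Appending \<open>M l - s\<close> at an even position lowers the excess of
      \<open>l\<close> to that of the lifted list and raises \<open>even_sum\<close> by the same
      amount, so the weights agree after z -> zq.\<close>
    then have ex': "excess l = excess (lift_lhp n s l) + (M l - s)"
        "excess (l @ [M l - s]) = excess (lift_lhp n s l)"
      using ex[OF l, of s] s by auto
    show "a p = x_weight (Suc i) (?h p)" "b p = y_weight (Suc i) (?h p)"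
      using ex' by (simp_all add: p a_def b_def x_weight_def y_weight_def ev[OF l] ev')
  qed
  also have "bivariate_gf ?T a b
      = bivariate_gf (UNIV \<times> ?P) (\<lambda>(s, l). x_weight (Suc i) l + Suc i * s)
          (\<lambda>(s, l). y_weight (Suc i) l + i * s)"
  proof (rule bivariate_gf_bij_betw)
    show "bij_betw (\<lambda>(s, l). (s - M l, l)) ?T (UNIV \<times> ?P)"
      by (rule bij_betw_byWitness[where f' = "\<lambda>(s, l). (s + M l, l)"]) auto
    fix p assume "p \<in> ?T"
    then obtain s l where p: "p = (s, l)" and l: "l \<in> ?P" and s: "M l \<le> s" by auto
    have "excess (lift_lhp n s l) = (s - M l) + excess l" using ex[OF l, of s] s by simp
    then show "a p = (case (case p of (s, l) \<Rightarrow> (s - M l, l)) of (s, l) \<Rightarrow> x_weight (Suc i) l + Suc i * s)"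
      "b p = (case (case p of (s, l) \<Rightarrow> (s - M l, l)) of (s, l) \<Rightarrow> y_weight (Suc i) l + i * s)"
      by (simp_all add: p a_def b_def x_weight_def y_weight_def ev[OF l] algebra_simps)
  qed
  finally show ?thesis
    using bivariate_gf_geometric[OF finite_fibres_positive_lhp, of "Suc i" n m "Suc i" i]
    by (simp only: distrib_right positive_gf_def)
qed

section \<open>Boundary cases and the sum over the number of positive entries\<close>

lemma positive_gf_0: "positive_gf i n 0 = 1"
proof -
  have "positive_lhp n 0 = {[]}" by (auto simp: positive_lhp_def)
  moreover have "x_weight i [] = 0" "y_weight i [] = 0"
    by (simp_all add: x_weight_def y_weight_def excess_def)
  then have "{l \<in> {[]}. x_weight i l = a \<and> y_weight i l = b} = (if a = 0 \<and> b = 0 then {[]} else {})" for a b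
    by auto
  ultimately show ?thesis
    by (simp add: fps_eq_iff positive_gf_def bivariate_gf_nth del: singleton_iff)
qed

lemma positive_gf_eq_0:
  assumes "n < m"
  shows "positive_gf i n m = 0"
proof -
  have "positive_lhp n m = {}"
    using assms lecture_hall_length by (fastforce simp: positive_lhp_def)
  then show ?thesis by (simp add: fps_eq_iff positive_gf_def bivariate_gf_nth)
qed

lemma weights_0:
  assumes "lecture_hall n l"
  shows "odd_sum l = x_weight 0 l" "even_sum l = y_weight 0 l"
  using even_sum_le_odd_sum[OF assms] by (simp_all add: x_weight_def y_weight_def excess_def)

text \<open>A list of length k + 1 either ends in 0, which can be deleted without changing the
  weights, or has only positive entries. Thus \<open>m\<close> counts the positive entries.\<close>

lemma bivariate_gf_truncated_lhp:
  "k \<le> n \<Longrightarrow> bivariate_gf (truncated_lhp n k) odd_sum even_sum = (\<Sum>m=0..k. positive_gf 0 n m)"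
proof (induction k)
  case 0
  then have "truncated_lhp n 0 = positive_lhp n 0" by (auto simp: truncated_lhp_eq positive_lhp_def)
  moreover have "bivariate_gf (positive_lhp n 0) odd_sum even_sum = positive_gf 0 n 0"
    unfolding positive_gf_def by (intro bivariate_gf_cong weights_0) (auto simp: positive_lhp_def)
  ultimately show ?case by simp
next
  case (Suc k)
  let ?Z = "(\<lambda>l. l @ [0]) ` truncated_lhp n k"
  have split: "truncated_lhp n (Suc k) = ?Z \<union> positive_lhp n (Suc k)"
  proof (intro equalityI subsetI)
    fix l assume "l \<in> truncated_lhp n (Suc k)"
    then have l: "length l = Suc k" "lecture_hall n l" using Suc.prems by (auto simp: truncated_lhp_eq)
    then obtain r c where rc: "l = r @ [c]" by (cases l rule: rev_cases) auto
    show "l \<in> ?Z \<union> positive_lhp n (Suc k)"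
    proof (cases "c = 0")
      case True
      then show ?thesis using l rc Suc.prems by (auto simp: truncated_lhp_eq lecture_hall_snoc_0)
    next
      case False
      then show ?thesis using l rc lecture_hall_snoc_pos[of n r c] by (auto simp: positive_lhp_def)
    qed
  qed (use Suc.prems in \<open>auto simp: truncated_lhp_eq lecture_hall_snoc_0 positive_lhp_def\<close>)
  have fin: "finite_fibres (truncated_lhp n (Suc k)) odd_sum even_sum"
    by (simp add: finite_fibres_def finite_truncated_lhp)
  have "bivariate_gf (truncated_lhp n (Suc k)) odd_sum even_sum
      = bivariate_gf ?Z odd_sum even_sum + bivariate_gf (positive_lhp n (Suc k)) odd_sum even_sum"
    unfolding split
    by (intro bivariate_gf_Un finite_fibres_inj_on[OF fin, of id])
       (auto simp: split positive_lhp_def)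
  also have "bivariate_gf ?Z odd_sum even_sum = bivariate_gf (truncated_lhp n k) odd_sum even_sum"
    by (rule sym, rule bivariate_gf_bij_betw[where h = "\<lambda>l. l @ [0]"])
       (auto simp: bij_betw_def inj_on_def entries_sum_snoc)
  also have "bivariate_gf (positive_lhp n (Suc k)) odd_sum even_sum = positive_gf 0 n (Suc k)"
    unfolding positive_gf_def by (intro bivariate_gf_cong weights_0) (auto simp: positive_lhp_def)
  finally show ?case using Suc by simp
qed

subsection \<open>Closed form\<close>

lemma qpoch_Suc: "qpoch a q (Suc m) = qpoch a q m * (1 - a * q ^ m)"
  by (simp add: qpoch_def)

lemma qpoch_Suc_shift: "qpoch a q (Suc m) = (1 - a) * qpoch (a * q) q m"
  unfolding qpoch_def by (subst prod.lessThan_Suc_shift) (simp add: mult.assoc)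

lemma qpoch_eq_prod_diff:
  assumes "m \<le> N"
  shows "qpoch (q ^ (N - m + 1)) q m = (\<Prod>i<m. 1 - q ^ (N - i))"
proof -
  have "qpoch (q ^ (N - m + 1)) q m = (\<Prod>i<m. 1 - q ^ (N - m + 1) * q ^ (m - Suc i))"
    unfolding qpoch_def by (rule prod.nat_diff_reindex[symmetric])
  also have "\<dots> = (\<Prod>i<m. 1 - q ^ (N - i))"
  proof (intro prod.cong refl)
    fix i assume "i \<in> {..<m}"
    then have "N - m + 1 + (m - Suc i) = N - i" using assms by simp
    then show "1 - q ^ (N - m + 1) * q ^ (m - Suc i) = 1 - q ^ (N - i)" by (metis power_add)
  qed
  finally show ?thesis .
qed

text \<open>The algebra of the induction step for length 2j + 2: \<open>P\<close> belongs to n + 1,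
  while \<open>P1\<close> and \<open>P2\<close> belong to n and lengths 2j + 2 and 2j + 1, with z
  replaced by zq. \<open>R\<close> and \<open>R1\<close> stand for (z;q)_{j+1} and (zq;q)_{j+1};
  multiplying by \<open>1 - z * q ^ Suc j\<close> turns one into the other.\<close>

lemma even_recurrence_step:
  fixes z q :: "'a::idom"
  assumes rec: "P * (1 - z) = P1 * (1 - z) + P2"
    and P1: "P1 * (R1 * (B * (1 - z * q ^ Suc N)) * (K * (1 - q ^ Suc j)))
           = (z * q * q ^ Suc j) ^ Suc j * (A * (1 - q ^ (N - j)))"
    and P2: "P2 * (R1 * B * K) = (z * q * q ^ j) ^ Suc j * A"
    and R: "R * (1 - z * q ^ Suc j) = (1 - z) * R1"
    and "j \<le> N" and nz: "1 - z * q ^ Suc j \<noteq> 0"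
  shows "P * (R * (B * (1 - z * q ^ Suc N)) * (K * (1 - q ^ Suc j)))
       = (z * q ^ Suc j) ^ Suc j * ((1 - q ^ Suc N) * A)"
proof -
  define w where "w = q ^ Suc j"
  define v where "v = q ^ (N - j)"
  define E where "E = (z * w) ^ Suc j"
  define b where "b = 1 - z * q ^ Suc N"
  have wv: "q ^ Suc N = w * v"
    using \<open>j \<le> N\<close> by (simp add: w_def v_def flip: power_add power_Suc)
  have E1: "(z * q * q ^ Suc j) ^ Suc j = E * w"
    by (simp only: E_def w_def power_mult_distrib flip: power_mult power_add) (simp add: algebra_simps)
  have E2: "(z * q * q ^ j) ^ Suc j = E" by (simp add: E_def w_def mult.assoc)
  have "P * (R * (B * b) * (K * (1 - w))) * (1 - z * w)
      = (P * (1 - z)) * (R1 * (B * b) * (K * (1 - w)))"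
    using R by (simp add: w_def)
  also have "\<dots> = (1 - z) * (P1 * (R1 * (B * b) * (K * (1 - w)))) + P2 * (R1 * B * K) * (b * (1 - w))"
    unfolding rec by (simp add: algebra_simps)
  also have "\<dots> = (1 - z) * (E * w * (A * (1 - v))) + E * A * (b * (1 - w))"
    using P1 P2 by (simp only: E1[folded w_def] E2 w_def[symmetric] v_def[symmetric] b_def[symmetric])
  \<comment> \<open>After division by E A this is (1-z)w(1-v) + (1-zwv)(1-w) = (1-wv)(1-zw).\<close>
  also have "\<dots> = E * ((1 - q ^ Suc N) * A) * (1 - z * w)"
    unfolding b_def wv by (simp add: algebra_simps)
  finally show ?thesis
    using nz by (simp add: w_def[symmetric] E_def[symmetric] b_def[symmetric] del: power_Suc)
qed

section \<open>Constant coefficients as a test for nonzero series\<close>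

definition const_coeff :: "rat fps fps \<Rightarrow> rat" where
  "const_coeff f = fps_nth (fps_nth f 0) 0"

lemma const_coeff_mult [simp]: "const_coeff (f * g) = const_coeff f * const_coeff g"
  by (simp add: const_coeff_def fps_mult_nth_0)

lemma const_coeff_simps [simp]:
  "const_coeff (f - g) = const_coeff f - const_coeff g"
  "const_coeff 1 = 1" "const_coeff 0 = 0"
  "const_coeff X = 0" "const_coeff Y = 0"
  by (simp_all add: const_coeff_def X_def Y_def)

lemma const_coeff_prod: "const_coeff (\<Prod>i\<in>I. f i) = (\<Prod>i\<in>I. const_coeff (f i))"
  by (induction I rule: infinite_finite_induct) simp_all

lemma const_coeff_nonzero: "const_coeff f \<noteq> 0 \<Longrightarrow> f \<noteq> 0"
  by auto

lemma const_coeff_qpoch: "const_coeff a = 0 \<Longrightarrow> const_coeff (qpoch a q m) = 1"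
  by (simp add: qpoch_def const_coeff_prod)

text \<open>Denominators are cleared, so the induction on \<open>n\<close> takes place in an
  integral domain. The shift \<open>i\<close> stays arbitrary because each recurrence raises it by
  one.\<close>

lemma positive_gf_closed_form:
  fixes i n m :: nat
  defines "q \<equiv> X * Y" and "z \<equiv> X * (X * Y) ^ i"
  assumes "m \<le> n"
  shows "positive_gf i n m * (qpoch z q (Suc m div 2)
           * (\<Prod>t<m div 2. 1 - z * q ^ (n - 1 - t)) * qpoch q q (m div 2))
       = (z * q ^ (m div 2)) ^ (Suc m div 2) * (\<Prod>t<m div 2. 1 - q ^ (n - Suc m div 2 - t))"
  using assms(3) unfolding z_def
proof (induction n arbitrary: i m)
  case 0
  then show ?case by (simp add: positive_gf_0 qpoch_def)
next
  case (Suc n)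
  define z where "z = X * (X * Y) ^ i"
  have z: "X ^ Suc i * Y ^ i = z" "X * (X * Y) ^ Suc i = z * q"
    by (simp_all add: z_def q_def power_mult_distrib algebra_simps)
  \<comment> \<open>Passing from (n + 1, z) to (n, zq) leaves this product unchanged.\<close>
  have prod_eq: "(\<Prod>t<j. 1 - z * q * q ^ (n - 1 - t)) = (\<Prod>t<j. 1 - z * q ^ (n - t))" if "j \<le> n" for j
    using that by (intro prod.cong) (auto simp: mult.assoc Suc_diff_Suc simp flip: power_Suc)
  consider "m = 0" | j where "m = Suc (2 * j)" | j where "m = Suc (Suc (2 * j))"
    by (metis One_nat_def Suc_eq_plus1 evenE oddE old.nat.exhaust even_Suc)
  then have "positive_gf i (Suc n) m * (qpoch z q (Suc m div 2)
           * (\<Prod>t<m div 2. 1 - z * q ^ (Suc n - 1 - t)) * qpoch q q (m div 2))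
       = (z * q ^ (m div 2)) ^ (Suc m div 2) * (\<Prod>t<m div 2. 1 - q ^ (Suc n - Suc m div 2 - t))"
  proof cases
    case 1
    then show ?thesis by (simp add: positive_gf_0 qpoch_def)
  next
    case (2 j)
    have rec: "positive_gf i (Suc n) m * (1 - z) = z * positive_gf (Suc i) n (2 * j)"
      using positive_gf_Suc_even[of "2 * j" i n] by (simp only: 2 z) simp
    have "positive_gf (Suc i) n (2 * j) * (qpoch (z * q) q j
           * (\<Prod>t<j. 1 - z * q ^ (n - t)) * qpoch q q j)
         = (z * q * q ^ j) ^ j * (\<Prod>t<j. 1 - q ^ (n - j - t))"
      using Suc.IH[of "2 * j" "Suc i"] Suc.prems 2 prod_eq[of j] by (simp add: z del: power_Suc)
    then have "z * positive_gf (Suc i) n (2 * j) * (qpoch (z * q) q j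
           * (\<Prod>t<j. 1 - z * q ^ (n - t)) * qpoch q q j)
         = z * (z * q * q ^ j) ^ j * (\<Prod>t<j. 1 - q ^ (n - j - t))"
      by (simp only: mult.assoc)
    also have "z * (z * q * q ^ j) ^ j = (z * q ^ j) ^ Suc j"
      by (simp add: power_mult_distrib algebra_simps)
    finally show ?thesis
      unfolding rec[symmetric] by (simp add: 2 qpoch_Suc_shift mult.assoc)
  next
    case (3 j)
    have n: "Suc (2 * j) \<le> n" using Suc.prems 3 by simp
    \<comment> \<open>The upper index of the Gaussian polynomial for \<open>n\<close> and both
      lengths 2j + 1 and 2j + 2; for n + 1 and length 2j + 2 it is \<open>Suc N\<close>.\<close>
    define N where "N = n - Suc j"
    have N: "j \<le> N" "n - j = Suc N" using n by (auto simp: N_def)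
    define B where "B = (\<Prod>t<j. 1 - z * q ^ (n - t))"
    define A where "A = (\<Prod>t<j. 1 - q ^ (N - t))"
    have B: "(\<Prod>t<Suc j. 1 - z * q ^ (n - t)) = B * (1 - z * q ^ Suc N)"
      by (simp add: B_def N)
    have rec: "positive_gf i (Suc n) m * (1 - z)
        = positive_gf (Suc i) n m * (1 - z) + positive_gf (Suc i) n (Suc (2 * j))"
      using positive_gf_Suc_odd[of "Suc (2 * j)" i n] by (simp only: 3 z) simp
    have P2: "positive_gf (Suc i) n (Suc (2 * j)) * (qpoch (z * q) q (Suc j) * B * qpoch q q j)
        = (z * q * q ^ j) ^ Suc j * A"
      using Suc.IH[of "Suc (2 * j)" "Suc i"] n prod_eq[of j]
      by (simp add: z B_def A_def N_def del: power_Suc)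
    have P1: "positive_gf (Suc i) n m * (qpoch (z * q) q (Suc j) * (B * (1 - z * q ^ Suc N))
          * (qpoch q q j * (1 - q ^ Suc j))) = (z * q * q ^ Suc j) ^ Suc j * (A * (1 - q ^ (N - j)))"
    proof (cases "m \<le> n")
      case True
      then show ?thesis
        using Suc.IH[of m "Suc i"] 3 prod_eq[of "Suc j"] n
        by (simp add: z B qpoch_Suc[of q] A_def N_def del: power_Suc prod.lessThan_Suc)
           (simp add: mult_ac)
    next
      \<comment> \<open>Here n = 2j + 1, outside the induction hypothesis, and both sides vanish: no
        such lists exist, and \<open>1 - q ^ (N - j)\<close> is 0.\<close>
      case False
      then have "N = j" using n 3 by (simp add: N_def)
      then show ?thesis using False by (simp add: positive_gf_eq_0)
    qed
    have "positive_gf i (Suc n) m * (qpoch z q (Suc j) * (B * (1 - z * q ^ Suc N))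
          * (qpoch q q j * (1 - q ^ Suc j))) = (z * q ^ Suc j) ^ Suc j * ((1 - q ^ Suc N) * A)"
    proof (rule even_recurrence_step[OF rec P1 P2 _ N(1)])
      show "qpoch z q (Suc j) * (1 - z * q ^ Suc j) = (1 - z) * qpoch (z * q) q (Suc j)"
        by (rule trans[OF qpoch_Suc[symmetric] qpoch_Suc_shift])
      show "1 - z * q ^ Suc j \<noteq> 0"
        by (rule const_coeff_nonzero) (simp add: z_def)
    qed
    moreover have "(\<Prod>t<Suc j. 1 - q ^ (Suc N - t)) = (1 - q ^ Suc N) * A"
      unfolding A_def by (subst prod.lessThan_Suc_shift) simp
    moreover have "n - j - t = Suc N - t" for t using N by simp
    ultimately show ?thesis
      using 3 B by (simp add: qpoch_Suc[of q] N del: power_Suc prod.lessThan_Suc)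
         (simp add: mult_ac)
  qed
  then show ?case by (simp only: z_def)
qed

text \<open>The case i = 0 of the cleared identity, where z q^(n-1-t) = x^(n-t) y^(n-1-t). All
  divisors have constant coefficient 1, so the quotients are genuine and common factors
  cancel.\<close>

lemma positive_gf_eq:
  assumes "m \<le> n"
  shows "positive_gf 0 n m
       = (X ^ (m div 2 + 1) * Y ^ (m div 2)) ^ (Suc m div 2)
           * gauss_poly (n - Suc m div 2) (m div 2) (X * Y)
         / (qpoch X (X * Y) (Suc m div 2) * qpoch_inv_base n (m div 2))"
proof -
  define q where "q = X * Y"
  define f where "f = m div 2"
  define c where "c = Suc m div 2"
  define D where "D = qpoch X q c * qpoch_inv_base n f"
  define N where "N = (X ^ (f + 1) * Y ^ f) ^ c * gauss_poly (n - c) f q"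
  have fc: "f + c = m" unfolding f_def c_def by presburger
  have base: "qpoch_inv_base n f = (\<Prod>t<f. 1 - X * q ^ (n - 1 - t))"
    unfolding qpoch_inv_base_def
  proof (intro prod.cong)
    fix t assume "t \<in> {..<f}"
    then have "n - t = Suc (n - 1 - t)" using fc assms by auto
    then show "1 - X ^ (n - t) * Y ^ (n - 1 - t) = 1 - X * q ^ (n - 1 - t)"
      by (simp add: q_def power_mult_distrib mult.assoc)
  qed simp
  have K: "const_coeff (qpoch q q f) = 1" and D: "const_coeff D = 1"
    by (simp_all add: D_def const_coeff_qpoch base const_coeff_prod q_def)
  have "positive_gf 0 n m * (D * qpoch q q f)
      = (X ^ (f + 1) * Y ^ f) ^ c * qpoch (q ^ (n - c - f + 1)) q f"
    using positive_gf_closed_form[OF assms, of 0] fc assms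
    unfolding D_def base
    by (subst qpoch_eq_prod_diff) (auto simp: f_def c_def q_def power_mult_distrib mult_ac)
  also have "\<dots> = N * qpoch q q f"
    using divide_bivariate_unit[of "qpoch q q f" "qpoch (q ^ (n - c - f + 1)) q f"] K
    by (simp add: N_def gauss_poly_def const_coeff_def mult.assoc)
  finally have "positive_gf 0 n m * D * qpoch q q f = N * qpoch q q f" by (simp only: mult.assoc)
  then have "positive_gf 0 n m * D = N" using const_coeff_nonzero[of "qpoch q q f"] K by simp
  also have "N = N / D * D"
    using divide_bivariate_unit[of D N] D by (simp add: const_coeff_def)
  finally have "positive_gf 0 n m = N / D" using const_coeff_nonzero[of D] D by simp
  then show ?thesis by (simp add: N_def D_def f_def c_def q_def)
qed

lemma nat_floor_half: "nat \<lfloor>real m / 2\<rfloor> = m div 2"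
  and nat_ceiling_half: "nat \<lceil>real m / 2\<rceil> = Suc m div 2"
proof -
  have "\<lfloor>real m / 2\<rfloor> = int (m div 2)" by (simp add: floor_divide_of_nat_eq[of m 2, simplified])
  then show "nat \<lfloor>real m / 2\<rfloor> = m div 2" by simp
  have "\<lceil>real m / 2\<rceil> = int (Suc m div 2)"
    by (rule ceiling_unique) (cases "even m"; auto elim!: evenE oddE)+
  then show "nat \<lceil>real m / 2\<rceil> = Suc m div 2" by simp
qed

theorem mainTheorem3:
  fixes n k :: nat
  assumes "k \<le> n"
  shows "bivariate_gf (truncated_lhp n k)
           (\<lambda>l. sum_list (odd_entries l)) (\<lambda>l. sum_list (even_entries l)) =
         (\<Sum>m = 0..k.
            (X ^ (nat \<lfloor>real m / 2\<rfloor> + 1) * Y ^ nat \<lfloor>real m / 2\<rfloor>) ^ nat \<lceil>real m / 2\<rceil>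
              * gauss_poly (n - nat \<lceil>real m / 2\<rceil>) (nat \<lfloor>real m / 2\<rfloor>) (X * Y)
            / (qpoch X (X * Y) (nat \<lceil>real m / 2\<rceil>)
                 * qpoch_inv_base n (nat \<lfloor>real m / 2\<rfloor>)))"
  unfolding bivariate_gf_truncated_lhp[OF assms] nat_floor_half nat_ceiling_half
  by (intro sum.cong positive_gf_eq) (use assms in auto)

end
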